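(* Let $p,\hat k\in\mathbb Z^2\setminus\{0\}$ with $\hat k+np\ne0$ for all $n\in\mathbb Z$, let $\Gamma\in\mathbb C$ and $a=\frac12|\Gamma|(p_1\hat k_2-p_2\hat k_1)$. Let $\mathcal L_C:\ell_2\to\ell_2$ be the bounded linear operator given, for $z=(z_1,z_2,\dots)$, by $$(\mathcal L_Cz)_1=ia[\tilde\rho_1z_2+\tilde\rho_{-1}z_3],\qquad(\mathcal L_Cz)_2=ia[\tilde\rho_0z_1+\tilde\rho_2z_4],$$ $$(\mathcal L_Cz)_{2n}=ia[\tilde\rho_{n-1}z_{2(n-1)}+\tilde\rho_{n+1}z_{2(n+1)}]\ (n\ge2),\qquad(\mathcal L_Cz)_{2n+1}=ia[\tilde\rho_{-n+1}z_{2(n-1)+1}+\tilde\rho_{-n-1}z_{2(n+1)+1}]\ (n\ge1).$$ Then $\mathcal L_C$ is a compact operator.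
   Context: Notation: $\rho_n=|\hat k+np|^{-2}-|p|^{-2}$, $\rho=-|p|^{-2}$ (the limit of $\rho_n$ as $|n|\to\infty$), and $\tilde\rho_n=\rho_n-\rho$. $\ell_2$ is the space of complex square-summable sequences indexed by $1,2,\dots$. *)

theory Defs
  imports "HOL-Analysis.Analysis"
begin

text \<open>The coordinates are indexed by \<open>1, 2, \<dots>\<close>; the unused coordinate \<open>0\<close> is pinned to \<open>0\<close>, so
  that an element of the type is exactly a square-summable sequence \<open>(z\<^sub>1, z\<^sub>2, \<dots>)\<close>.\<close>

typedef ell2 = "{z :: nat \<Rightarrow> complex. z 0 = 0 \<and> summable (\<lambda>n. (norm (z n))\<^sup>2)}"
  morphisms coord Abs_ell2
  by (rule exI[of _ "\<lambda>_. 0"]) simp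

setup_lifting type_definition_ell2

lemma ell2_eqI: "(\<And>n. coord x n = coord y n) \<Longrightarrow> x = y"
  by (simp add: coord_inject[symmetric] fun_eq_iff)

lemma coord_zero_index [simp]: "coord x 0 = 0"
  and summable_coord: "summable (\<lambda>n. (norm (coord x n))\<^sup>2)"
  using coord[of x] by auto

lemma norm_add_sq_le: "(norm (x + y))\<^sup>2 \<le> 2 * (norm x)\<^sup>2 + 2 * (norm (y :: complex))\<^sup>2"
proof -
  have "(norm (x + y))\<^sup>2 \<le> (norm x + norm y)\<^sup>2"
    by (intro power_mono norm_triangle_ineq) auto
  also have "\<dots> \<le> 2 * (norm x)\<^sup>2 + 2 * (norm y)\<^sup>2"
    using zero_le_power2[of "norm x - norm y"] by (simp add: power2_eq_square algebra_simps)
  finally show ?thesis .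
qed

lemma summable_norm_sq_add:
  fixes f g :: "nat \<Rightarrow> complex"
  assumes "summable (\<lambda>n. (norm (f n))\<^sup>2)" "summable (\<lambda>n. (norm (g n))\<^sup>2)"
  shows "summable (\<lambda>n. (norm (f n + g n))\<^sup>2)"
  by (rule summable_comparison_test'[where N = 0,
        OF summable_add[OF summable_mult[OF assms(1), of 2] summable_mult[OF assms(2), of 2]]])
     (use norm_add_sq_le in auto)

lemma summable_norm_sq_mult:
  fixes f :: "nat \<Rightarrow> complex"
  assumes "summable (\<lambda>n. (norm (f n))\<^sup>2)"
  shows "summable (\<lambda>n. (norm (c * f n))\<^sup>2)"
  using summable_mult[OF assms, of "(norm c)\<^sup>2"] by (simp add: norm_mult power_mult_distrib)

instantiation ell2 :: real_vector
begin

lift_definition zero_ell2 :: ell2 is "\<lambda>_. 0" by simp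

lift_definition plus_ell2 :: "ell2 \<Rightarrow> ell2 \<Rightarrow> ell2" is "\<lambda>x y n. x n + y n"
  using summable_norm_sq_add by auto

lift_definition uminus_ell2 :: "ell2 \<Rightarrow> ell2" is "\<lambda>x n. - x n" by simp

lift_definition minus_ell2 :: "ell2 \<Rightarrow> ell2 \<Rightarrow> ell2" is "\<lambda>x y n. x n - y n"
  using summable_norm_sq_add[of _ "\<lambda>n. - _ n"] by auto

lift_definition scaleR_ell2 :: "real \<Rightarrow> ell2 \<Rightarrow> ell2" is "\<lambda>c x n. c *\<^sub>R x n"
  using summable_norm_sq_mult by (auto simp: scaleR_conv_of_real)

instance
proof
  fix x y z :: ell2 and r s :: real
  show "x + y + z = x + (y + z)" by transfer (simp add: add.assoc)
  show "x + y = y + x" by transfer (simp add: add.commute)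
  show "0 + x = x" by transfer simp
  show "- x + x = 0" by transfer simp
  show "x - y = x + - y" by transfer simp
  show "r *\<^sub>R (x + y) = r *\<^sub>R x + r *\<^sub>R y" by transfer (simp add: algebra_simps)
  show "(r + s) *\<^sub>R x = r *\<^sub>R x + s *\<^sub>R x" by transfer (simp add: algebra_simps)
  show "r *\<^sub>R s *\<^sub>R x = (r * s) *\<^sub>R x" by transfer simp
  show "1 *\<^sub>R x = x" by transfer simp
qed

end

text \<open>The norm is the usual one, \<open>sqrt (\<Sum>n. \<bar>z\<^sub>n\<bar>\<^sup>2)\<close>; the real inner product is the real part of
  the Hermitian inner product.\<close>

instantiation ell2 :: real_inner
begin

definition inner_ell2 :: "ell2 \<Rightarrow> ell2 \<Rightarrow> real"
  where "inner_ell2 x y = (\<Sum>n. inner (coord x n) (coord y n))"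

definition norm_ell2 :: "ell2 \<Rightarrow> real"
  where "norm_ell2 x = sqrt (\<Sum>n. (norm (coord x n))\<^sup>2)"

definition dist_ell2 :: "ell2 \<Rightarrow> ell2 \<Rightarrow> real"
  where "dist_ell2 x y = norm (x - y)"

definition sgn_ell2 :: "ell2 \<Rightarrow> ell2"
  where "sgn_ell2 x = x /\<^sub>R norm x"

definition uniformity_ell2 :: "(ell2 \<times> ell2) filter"
  where "uniformity_ell2 = (INF e\<in>{0 <..}. principal {(x, y). dist x y < e})"

definition open_ell2 :: "ell2 set \<Rightarrow> bool"
  where "open_ell2 U = (\<forall>x\<in>U. eventually (\<lambda>(x', y). x' = x \<longrightarrow> y \<in> U) uniformity)"

lemma summable_inner_coord: "summable (\<lambda>n. inner (coord x n) (coord y n))"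
proof (rule summable_comparison_test'[where N = 0,
        OF summable_add[OF summable_coord[of x] summable_coord[of y]]])
  fix n
  have "norm (inner (coord x n) (coord y n)) \<le> norm (coord x n) * norm (coord y n)"
    using Cauchy_Schwarz_ineq2 by simp
  also have "\<dots> \<le> (norm (coord x n))\<^sup>2 + (norm (coord y n))\<^sup>2"
    using zero_le_power2[of "norm (coord x n) - norm (coord y n)"]
      mult_nonneg_nonneg[OF norm_ge_zero[of "coord x n"] norm_ge_zero[of "coord y n"]]
    unfolding power2_diff by linarith
  finally show "norm (inner (coord x n) (coord y n)) \<le> (norm (coord x n))\<^sup>2 + (norm (coord y n))\<^sup>2" .
qed

instance
proof
  fix x y z :: ell2 and r s :: real
  show "dist x y = norm (x - y)" by (rule dist_ell2_def)
  show "sgn x = x /\<^sub>R norm x" by (rule sgn_ell2_def)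
  show "uniformity = (INF e\<in>{0 <..}. principal {(x, y :: ell2). dist x y < e})"
    by (rule uniformity_ell2_def)
  show "open U = (\<forall>x\<in>U. eventually (\<lambda>(x', y). x' = x \<longrightarrow> y \<in> U) uniformity)" for U :: "ell2 set"
    by (rule open_ell2_def)
  show "inner x y = inner y x" by (simp add: inner_ell2_def inner_commute)
  show "inner (x + y) z = inner x z + inner y z"
    unfolding inner_ell2_def plus_ell2.rep_eq inner_add_left
    by (rule suminf_add[symmetric]) (rule summable_inner_coord)+
  show "inner (r *\<^sub>R x) y = r * inner x y"
    unfolding inner_ell2_def scaleR_ell2.rep_eq inner_scaleR_left
    by (rule suminf_mult) (rule summable_inner_coord)
  show "0 \<le> inner x x"
    unfolding inner_ell2_def by (rule suminf_nonneg[OF summable_inner_coord]) simp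
  have "inner x x = 0 \<longleftrightarrow> (\<forall>n. inner (coord x n) (coord x n) = 0)"
    unfolding inner_ell2_def by (rule suminf_eq_zero_iff[OF summable_inner_coord]) simp
  also have "\<dots> \<longleftrightarrow> x = 0" by (auto intro!: ell2_eqI simp: zero_ell2.rep_eq)
  finally show "inner x x = 0 \<longleftrightarrow> x = 0" .
  show "norm x = sqrt (inner x x)"
    by (simp add: norm_ell2_def inner_ell2_def power2_norm_eq_inner)
qed

end

lift_definition scaleC :: "complex \<Rightarrow> ell2 \<Rightarrow> ell2" (infixr "*\<^sub>C" 75) is "\<lambda>c x n. c * x n"
  using summable_norm_sq_mult by auto

definition clinear_op :: "(ell2 \<Rightarrow> ell2) \<Rightarrow> bool" where
  "clinear_op T \<longleftrightarrow> (\<forall>x y. T (x + y) = T x + T y) \<and> (\<forall>c x. T (c *\<^sub>C x) = c *\<^sub>C T x)"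

definition bounded_clinear_op :: "(ell2 \<Rightarrow> ell2) \<Rightarrow> bool" where
  "bounded_clinear_op T \<longleftrightarrow> clinear_op T \<and> (\<exists>K. \<forall>x. norm (T x) \<le> norm x * K)"

definition compact_op :: "(ell2 \<Rightarrow> ell2) \<Rightarrow> bool" where
  "compact_op T \<longleftrightarrow> bounded_clinear_op T \<and> (\<forall>S. bounded S \<longrightarrow> compact (closure (T ` S)))"

definition vnorm :: "int ^ 2 \<Rightarrow> real" where
  "vnorm v = norm (\<chi> i. real_of_int (v $ i) :: real ^ 2)"

definition rho_lim :: "int ^ 2 \<Rightarrow> real" where
  "rho_lim p = - (1 / (vnorm p)\<^sup>2)"

definition rho :: "int ^ 2 \<Rightarrow> int ^ 2 \<Rightarrow> int \<Rightarrow> real" where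
  "rho k p n = 1 / (vnorm (k + n *s p))\<^sup>2 - 1 / (vnorm p)\<^sup>2"

definition rho_tilde :: "int ^ 2 \<Rightarrow> int ^ 2 \<Rightarrow> int \<Rightarrow> real" where
  "rho_tilde k p n = rho k p n - rho_lim p"

definition a_coef :: "int ^ 2 \<Rightarrow> int ^ 2 \<Rightarrow> complex \<Rightarrow> real" where
  "a_coef k p \<Gamma> = 1 / 2 * norm \<Gamma> * real_of_int (p $ 1 * k $ 2 - p $ 2 * k $ 1)"

definition LC_seq :: "int ^ 2 \<Rightarrow> int ^ 2 \<Rightarrow> complex \<Rightarrow> (nat \<Rightarrow> complex) \<Rightarrow> nat \<Rightarrow> complex" where
  "LC_seq k p \<Gamma> z m =
    (let r = (\<lambda>n. complex_of_real (rho_tilde k p n)); a = complex_of_real (a_coef k p \<Gamma>);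
         n = m div 2
     in if m = 0 then 0
        else if m = 1 then \<i> * a * (r 1 * z 2 + r (- 1) * z 3)
        else if m = 2 then \<i> * a * (r 0 * z 1 + r 2 * z 4)
        else if even m then
          \<i> * a * (r (int n - 1) * z (2 * (n - 1)) + r (int n + 1) * z (2 * (n + 1)))
        else
          \<i> * a * (r (- int n + 1) * z (2 * (n - 1) + 1) + r (- int n - 1) * z (2 * (n + 1) + 1)))"

text \<open>The operator is well defined for all parameters: since \<open>k + n p\<close> is an integer vector,
  \<open>0 \<le> rho_tilde k p n \<le> 1\<close> (with \<open>1 / 0 = 0\<close>).\<close>

lemma rho_tilde_eq: "rho_tilde k p n = 1 / (vnorm (k + n *s p))\<^sup>2"
  by (simp add: rho_tilde_def rho_def rho_lim_def)

lemma vnorm_sq: "(vnorm v)\<^sup>2 = real_of_int ((v $ 1)\<^sup>2 + (v $ 2)\<^sup>2)"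
  by (simp add: vnorm_def norm_vec_def L2_set_def sum_2)

lemma rho_tilde_bounds: "0 \<le> rho_tilde k p n" "rho_tilde k p n \<le> 1"
proof -
  show "0 \<le> rho_tilde k p n" by (simp add: rho_tilde_eq)
  define N where "N = ((k + n *s p) $ 1)\<^sup>2 + ((k + n *s p) $ 2)\<^sup>2"
  have "N = 0 \<or> N \<ge> 1" unfolding N_def
    by (smt (verit) zero_le_power2)
  then have "1 / real_of_int N \<le> 1" by auto
  then show "rho_tilde k p n \<le> 1" by (simp only: rho_tilde_eq vnorm_sq N_def)
qed

lemma LC_seq_summable:
  assumes "summable (\<lambda>n. (norm (z n))\<^sup>2)"
  shows "summable (\<lambda>n. (norm (LC_seq k p \<Gamma> z n))\<^sup>2)"
proof -
  define A where "A = norm (complex_of_real (a_coef k p \<Gamma>))"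
  define B where "B = 2 * A\<^sup>2"
  let ?w = "\<lambda>m. (norm (z (m - 2)))\<^sup>2 + (norm (z (m + 2)))\<^sup>2"
  have bnd: "(norm (\<i> * complex_of_real (a_coef k p \<Gamma>) *
        (complex_of_real (rho_tilde k p s) * u + complex_of_real (rho_tilde k p t) * v)))\<^sup>2
      \<le> B * ((norm u)\<^sup>2 + (norm v)\<^sup>2)" for s t u v
  proof -
    have q: "(norm (complex_of_real (rho_tilde k p s) * u))\<^sup>2 \<le> (norm u)\<^sup>2" for s u
      using rho_tilde_bounds[of k p s]
      by (intro power_mono) (auto simp: norm_mult intro: mult_left_le_one_le)
    have "(norm (complex_of_real (rho_tilde k p s) * u + complex_of_real (rho_tilde k p t) * v))\<^sup>2
       \<le> 2 * (norm u)\<^sup>2 + 2 * (norm v)\<^sup>2"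
      by (rule order_trans[OF norm_add_sq_le]) (intro add_mono mult_left_mono q; simp)
    from mult_left_mono[OF this, of "A\<^sup>2"] show ?thesis
      unfolding norm_mult[of "\<i> * _"] power_mult_distrib
      by (simp add: norm_mult A_def B_def ring_distribs mult_ac)
  qed
  have "summable (\<lambda>m. (norm (z (m + 2)))\<^sup>2)"
    using assms by (rule summable_ignore_initial_segment)
  moreover have "summable (\<lambda>m. (norm (z (m - 2)))\<^sup>2)"
    using assms by (subst summable_iff_shift[symmetric, of _ 2]) simp
  ultimately have "summable (\<lambda>m. B * ?w m)" by (intro summable_mult summable_add)
  then show ?thesis
  proof (rule summable_comparison_test'[where N = 3])
    fix m :: nat assume m: "3 \<le> m"
    show "norm ((norm (LC_seq k p \<Gamma> z m))\<^sup>2) \<le> B * ?w m"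
    proof (cases "even m")
      case True
      then have "2 * (m div 2 - 1) = m - 2" "2 * (m div 2 + 1) = m + 2" by auto
      with m True bnd show ?thesis by (simp add: LC_seq_def Let_def)
    next
      case False
      then have "2 * (m div 2 - 1) + 1 = m - 2" "2 * (m div 2 + 1) + 1 = m + 2"
        using m by presburger+
      with m False bnd show ?thesis by (simp add: LC_seq_def Let_def)
    qed
  qed
qed

lift_definition LC :: "int ^ 2 \<Rightarrow> int ^ 2 \<Rightarrow> complex \<Rightarrow> ell2 \<Rightarrow> ell2" is LC_seq
  using LC_seq_summable by (auto simp: LC_seq_def)

lemma LC_coords:
  fixes k p :: "int ^ 2" and \<Gamma> :: complex and z :: ell2 and n :: nat
  defines "a \<equiv> complex_of_real (a_coef k p \<Gamma>)"
    and "r \<equiv> (\<lambda>j. complex_of_real (rho_tilde k p j))"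
  shows "coord (LC k p \<Gamma> z) 1 = \<i> * a * (r 1 * coord z 2 + r (- 1) * coord z 3)"
    and "coord (LC k p \<Gamma> z) 2 = \<i> * a * (r 0 * coord z 1 + r 2 * coord z 4)"
    and "n \<ge> 2 \<Longrightarrow> coord (LC k p \<Gamma> z) (2 * n) =
      \<i> * a * (r (int n - 1) * coord z (2 * (n - 1)) + r (int n + 1) * coord z (2 * (n + 1)))"
    and "n \<ge> 1 \<Longrightarrow> coord (LC k p \<Gamma> z) (2 * n + 1) =
      \<i> * a * (r (- int n + 1) * coord z (2 * (n - 1) + 1)
        + r (- int n - 1) * coord z (2 * (n + 1) + 1))"
  by (auto simp: LC.rep_eq LC_seq_def Let_def a_def r_def)

end

theory Submission
  imports Defs
begin

text \<open>Since \<open>|k + n p|\<close> grows linearly in \<open>|n|\<close>, the coefficients of the operator decay like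
  \<open>1 / m\<^sup>2\<close>, which is a square-summable weight. The image of a bounded set
  therefore lies in a Hilbert cube \<open>{x. \<forall>m. |x\<^sub>m| \<le> w\<^sub>m}\<close> with \<open>w\<close> square summable,
  and such a cube is compact: Tychonoff gives coordinatewise convergent subsequences, and
  dominated convergence upgrades this to norm convergence.\<close>

lemma norm_ell2_sq: "(norm x)\<^sup>2 = (\<Sum>n. (norm (coord x n))\<^sup>2)"
  by (simp add: norm_ell2_def suminf_nonneg[OF summable_coord])

lemma norm_coord_le: "norm (coord x n) \<le> norm x"
proof -
  have "(norm (coord x n))\<^sup>2 \<le> (norm x)\<^sup>2"
    using sum_le_suminf[OF summable_coord[of x], of "{n}"] by (simp add: norm_ell2_sq)
  then show ?thesis by (rule power2_le_imp_le) simp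
qed

text \<open>The limit inherits the bound \<open>w\<close>, so the terms of the squared distance are
  at most \<open>(2 * w m)\<^sup>2\<close>. Tannery's theorem, which is dominated convergence for
  series, then allows the limit to be taken term by term.\<close>

lemma tendsto_ell2_dominated:
  fixes f :: "nat \<Rightarrow> ell2"
  assumes lim: "\<And>m. (\<lambda>n. coord (f n) m) \<longlonglongrightarrow> coord l m"
    and bound: "\<And>n m. norm (coord (f n) m) \<le> w m"
    and w: "summable (\<lambda>m. (w m)\<^sup>2)"
  shows "f \<longlonglongrightarrow> l"
proof -
  have l: "norm (coord l m) \<le> w m" for m
    by (rule Lim_bounded[OF tendsto_norm[OF lim]]) (use bound in auto)
  have dominated: "norm ((norm (coord (f n - l) m))\<^sup>2) \<le> 4 * (w m)\<^sup>2" for n m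
  proof -
    have "norm (coord (f n - l) m) \<le> 2 * w m"
      using norm_triangle_ineq4[of "coord (f n) m" "coord l m"] bound[of n m] l[of m]
      by (simp add: minus_ell2.rep_eq)
    then have "(norm (coord (f n - l) m))\<^sup>2 \<le> (2 * w m)\<^sup>2"
      by (intro power_mono) auto
    then show ?thesis by (simp add: power_mult_distrib)
  qed
  have pointwise: "(\<lambda>n. (norm (coord (f n - l) m))\<^sup>2) \<longlonglongrightarrow> 0" for m
  proof -
    have "(\<lambda>n. (norm (coord (f n) m - coord l m))\<^sup>2) \<longlonglongrightarrow> (norm (coord l m - coord l m))\<^sup>2"
      by (intro tendsto_intros lim)
    then show ?thesis by (simp add: minus_ell2.rep_eq)
  qed
  have "(\<lambda>n. \<Sum>m. (norm (coord (f n - l) m))\<^sup>2) \<longlonglongrightarrow> (\<Sum>m. 0)"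
  proof (intro conjunct2[OF conjunct2[OF tannerys_theorem]])
    show "summable (\<lambda>m. 4 * (w m)\<^sup>2)"
      by (rule summable_mult[OF w])
    show "eventually (\<lambda>(m, n). norm ((norm (coord (f n - l) m))\<^sup>2) \<le> 4 * (w m)\<^sup>2)
        (at_top \<times>\<^sub>F sequentially)"
      by (rule always_eventually) (use dominated in blast)
  qed (simp_all add: pointwise)
  then have "(\<lambda>n. sqrt ((norm (f n - l))\<^sup>2)) \<longlonglongrightarrow> sqrt 0"
    by (intro tendsto_real_sqrt) (simp add: norm_ell2_sq)
  then show ?thesis
    by (simp add: LIM_zero_iff tendsto_norm_zero_iff)
qed

lemma compact_hilbert_cube:
  assumes w: "summable (\<lambda>m. (w m)\<^sup>2)"
  shows "compact {x. \<forall>m. norm (coord x m) \<le> w m}"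
  unfolding compact_eq_seq_compact_metric seq_compact_def
proof (intro allI impI)
  fix f :: "nat \<Rightarrow> ell2"
  assume f: "\<forall>n. f n \<in> {x. \<forall>m. norm (coord x m) \<le> w m}"
  define P where "P = (\<Pi>\<^sub>E m\<in>UNIV. cball (0::complex) (w m))"
  \<comment> \<open>Tychonoff's theorem for the product of closed discs. The index set is countable,
    so the function space is first countable and compactness yields convergent subsequences.\<close>
  have "compactin (product_topology (\<lambda>_. euclidean) UNIV) P"
    unfolding P_def by (subst compactin_PiE) auto
  then have "seq_compact P"
    by (simp add: euclidean_product_topology compact_imp_seq_compact)
  moreover have "\<forall>n. coord (f n) \<in> P"
    using f by (auto simp: P_def)
  ultimately obtain g r where g: "g \<in> P" and r: "strict_mono (r :: nat \<Rightarrow> nat)"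
    and conv: "((\<lambda>n. coord (f n)) \<circ> r) \<longlonglongrightarrow> g"
    by (rule seq_compactE)
  have lim: "(\<lambda>n. coord (f (r n)) m) \<longlonglongrightarrow> g m" for m
  proof -
    have "continuous_on UNIV (\<lambda>h :: nat \<Rightarrow> complex. h m)"
      by (rule continuous_on_product_coordinates)
    from continuous_on_tendsto_compose[OF this conv] show ?thesis by simp
  qed
  have gw: "norm (g m) \<le> w m" for m
    using g by (auto simp: P_def PiE_def Pi_def)
  \<comment> \<open>The pointwise limit is so far only a function. To be an element of
    \<open>ell2\<close> it must vanish at the pinned index 0 and be square summable.\<close>
  have "(\<lambda>n. coord (f (r n)) 0) \<longlonglongrightarrow> 0" by simp
  then have "g 0 = 0" using lim[of 0] LIMSEQ_unique by blast
  moreover have "summable (\<lambda>m. (norm (g m))\<^sup>2)"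
    by (rule summable_comparison_test'[OF w, of 0]) (use gw in \<open>simp add: power_mono\<close>)
  ultimately have coord_l: "coord (Abs_ell2 g) = g"
    by (simp add: Abs_ell2_inverse)
  have "(\<lambda>n. f (r n)) \<longlonglongrightarrow> Abs_ell2 g"
    by (rule tendsto_ell2_dominated[OF _ _ w]) (use lim f in \<open>auto simp: coord_l\<close>)
  then show "\<exists>l\<in>{x. \<forall>m. norm (coord x m) \<le> w m}. \<exists>r. strict_mono r \<and> (f \<circ> r) \<longlonglongrightarrow> l"
    using r gw by (intro bexI[of _ "Abs_ell2 g"] exI[of _ r]) (auto simp: coord_l o_def)
qed

text \<open>Summing the squared bounds gives boundedness with constant
  \<open>sqrt (\<Sum>m. (w m)\<^sup>2)\<close>. If \<open>S\<close> has norm bound \<open>M\<close>,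
  its image lies in the cube with radii \<open>M * w m\<close>. This cube is compact, hence closed,
  so it also contains the closure of the image.\<close>

lemma compact_op_if_coord_dominated:
  assumes lin: "clinear_op T"
    and w: "summable (\<lambda>m. (w m)\<^sup>2)" "\<And>m. 0 \<le> w m"
    and bound: "\<And>x m. norm (coord (T x) m) \<le> norm x * w m"
  shows "compact_op T"
  unfolding compact_op_def bounded_clinear_op_def
proof (intro conjI lin allI impI exI)
  fix x
  have "(norm (T x))\<^sup>2 \<le> (\<Sum>m. (norm x)\<^sup>2 * (w m)\<^sup>2)"
    unfolding norm_ell2_sq[of "T x"]
    by (rule suminf_le[OF _ summable_coord summable_mult[OF w(1)]])
       (use bound in \<open>simp add: power_mono flip: power_mult_distrib\<close>)
  also have "\<dots> = (norm x * sqrt (\<Sum>m. (w m)\<^sup>2))\<^sup>2"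
    by (simp add: suminf_mult[OF w(1)] power_mult_distrib suminf_nonneg[OF w(1)])
  finally show "norm (T x) \<le> norm x * sqrt (\<Sum>m. (w m)\<^sup>2)"
    by (rule power2_le_imp_le) (simp add: suminf_nonneg[OF w(1)])
next
  fix S :: "ell2 set"
  assume "bounded S"
  then obtain M where M: "\<And>x. x \<in> S \<Longrightarrow> norm x \<le> M"
    unfolding bounded_iff by blast
  have "compact {x. \<forall>m. norm (coord x m) \<le> M * w m}" (is "compact ?Q")
    by (rule compact_hilbert_cube) (simp add: power_mult_distrib summable_mult w(1))
  moreover have "T ` S \<subseteq> ?Q"
    using order_trans[OF bound mult_right_mono[OF M w(2)]] by auto
  ultimately show "compact (closure (T ` S))"
    using compact_Int_closed[of ?Q "closure (T ` S)"] closure_minimal[of "T ` S" ?Q]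
    by (simp add: compact_imp_closed Int_absorb1)
qed

text \<open>The squared length of a nonzero integer vector is a positive integer.\<close>

lemma vnorm_ge_1:
  assumes "v \<noteq> 0" shows "1 \<le> vnorm v"
proof -
  have "v $ 1 \<noteq> 0 \<or> v $ 2 \<noteq> 0"
    using assms by (auto simp: vec_eq_iff forall_2)
  then have "0 < (v $ 1)\<^sup>2 + (v $ 2)\<^sup>2"
    by (simp add: sum_power2_gt_zero_iff)
  then have "1\<^sup>2 \<le> (vnorm v)\<^sup>2"
    unfolding vnorm_sq by (simp flip: of_int_power of_int_add)
  then show ?thesis by (rule power2_le_imp_le) (simp add: vnorm_def)
qed

text \<open>Triangle inequality for \<open>n *s p\<close> as the difference of
  \<open>k + n *s p\<close> and \<open>k\<close>, carried out in \<open>real ^ 2\<close>, where the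
  norm lives.\<close>

lemma vnorm_smult_le: "\<bar>real_of_int n\<bar> * vnorm p \<le> vnorm (k + n *s p) + vnorm k"
proof -
  define emb :: "int ^ 2 \<Rightarrow> real ^ 2" where "emb v = (\<chi> i. real_of_int (v $ i))" for v
  have "emb (k + n *s p) = emb k + real_of_int n *\<^sub>R emb p"
    by (simp add: emb_def vec_eq_iff)
  then have "\<bar>real_of_int n\<bar> * norm (emb p) = norm (emb (k + n *s p) - emb k)"
    by simp
  also have "\<dots> \<le> norm (emb (k + n *s p)) + norm (emb k)"
    by (rule norm_triangle_ineq4)
  finally show ?thesis by (simp add: vnorm_def emb_def)
qed

text \<open>With \<open>?v >= 1\<close> and \<open>vnorm p >= 1\<close>, the chain
  \<open>|n| <= |n| * vnorm p <= ?v + vnorm k <= (1 + vnorm k) * ?v\<close> holds; adding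
  \<open>1 <= ?v\<close> produces the constant \<open>2 + vnorm k\<close>. The shift by 1 in the
  denominator keeps the bound meaningful at \<open>n = 0\<close>.\<close>

lemma rho_tilde_decay:
  assumes "p \<noteq> 0" and "k + n *s p \<noteq> 0"
  shows "rho_tilde k p n \<le> (2 + vnorm k)\<^sup>2 / (\<bar>real_of_int n\<bar> + 1)\<^sup>2"
proof -
  let ?v = "vnorm (k + n *s p)"
  have v: "1 \<le> ?v"
    using assms(2) by (rule vnorm_ge_1)
  have k: "0 \<le> vnorm k"
    by (simp add: vnorm_def)
  have "\<bar>real_of_int n\<bar> \<le> \<bar>real_of_int n\<bar> * vnorm p"
    using mult_left_mono[OF vnorm_ge_1[OF assms(1)], of "\<bar>real_of_int n\<bar>"] by simp
  also note vnorm_smult_le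
  also have "vnorm k \<le> vnorm k * ?v"
    using mult_left_mono[OF v k] by simp
  finally have "\<bar>real_of_int n\<bar> + 1 \<le> (2 + vnorm k) * ?v"
    using v by (simp add: algebra_simps)
  then have "(\<bar>real_of_int n\<bar> + 1)\<^sup>2 \<le> (2 + vnorm k)\<^sup>2 * ?v\<^sup>2"
    unfolding power_mult_distrib[symmetric] by (intro power_mono) auto
  then show ?thesis
    using v unfolding rho_tilde_eq by (simp add: divide_simps)
qed

lemma clinear_op_LC: "clinear_op (LC k p \<Gamma>)"
  unfolding clinear_op_def
  by (auto intro!: ell2_eqI
      simp: LC.rep_eq plus_ell2.rep_eq scaleC.rep_eq LC_seq_def Let_def algebra_simps)

text \<open>Each row has two summands, and each coefficient in row \<open>m\<close> decays like
  \<open>1 / m\<^sup>2\<close>. The constant 32 is the factor 2 for the summands times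
  \<open>4\<^sup>2\<close> from comparing \<open>m\<close> with
  \<open>4 * (|s| + 1)\<close>.\<close>

lemma LC_coord_bound:
  fixes z :: ell2
  assumes "p \<noteq> 0" and "\<forall>n :: int. k + n *s p \<noteq> 0"
  shows "norm (coord (LC k p \<Gamma> z) m)
    \<le> norm z * (32 * \<bar>a_coef k p \<Gamma>\<bar> * (2 + vnorm k)\<^sup>2 / (real m)\<^sup>2)"
proof (cases "m = 0")
  case False
  define D where "D = 16 * (2 + vnorm k)\<^sup>2 / (real m)\<^sup>2"
  \<comment> \<open>Every index \<open>s\<close> of a coefficient in row \<open>m\<close> satisfies this premise.\<close>
  have coeff: "rho_tilde k p s \<le> D" if "int m \<le> 4 * (\<bar>s\<bar> + 1)" for s
  proof -
    have "real m \<le> 4 * (\<bar>real_of_int s\<bar> + 1)"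
      using of_int_le_iff[where 'a = real, THEN iffD2, OF that] by simp
    then have "(real m)\<^sup>2 \<le> (4 * (\<bar>real_of_int s\<bar> + 1))\<^sup>2"
      by (intro power_mono) auto
    then have "(real m)\<^sup>2 \<le> 16 * (\<bar>real_of_int s\<bar> + 1)\<^sup>2"
      by (simp only: power_mult_distrib) simp
    moreover have "0 < (\<bar>real_of_int s\<bar> + 1)\<^sup>2" by simp
    ultimately have "1 / (\<bar>real_of_int s\<bar> + 1)\<^sup>2 \<le> 16 / (real m)\<^sup>2"
      using False by (simp add: divide_simps)
    from mult_left_mono[OF this, of "(2 + vnorm k)\<^sup>2"]
    have "(2 + vnorm k)\<^sup>2 / (\<bar>real_of_int s\<bar> + 1)\<^sup>2 \<le> D"
      by (simp add: D_def mult_ac)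
    with rho_tilde_decay[OF assms(1)] assms(2) show ?thesis by (meson order_trans)
  qed
  have summand: "norm (complex_of_real (rho_tilde k p s) * coord z i) \<le> D * norm z"
    if "int m \<le> 4 * (\<bar>s\<bar> + 1)" for s i
    using coeff[OF that] rho_tilde_bounds(1)[of k p s] norm_coord_le[of z i]
    by (simp add: norm_mult mult_mono)
  have sum_bound: "norm (\<i> * complex_of_real (a_coef k p \<Gamma>) *
      (complex_of_real (rho_tilde k p s) * coord z i + complex_of_real (rho_tilde k p t) * coord z j))
      \<le> \<bar>a_coef k p \<Gamma>\<bar> * (2 * (D * norm z))"
    if "int m \<le> 4 * (\<bar>s\<bar> + 1)" "int m \<le> 4 * (\<bar>t\<bar> + 1)" for s t i j
  proof -
    have "norm (complex_of_real (rho_tilde k p s) * coord z i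
        + complex_of_real (rho_tilde k p t) * coord z j) \<le> 2 * (D * norm z)"
      using norm_triangle_mono[OF summand[OF that(1)] summand[OF that(2)]] by simp
    then show ?thesis by (simp add: norm_mult mult_left_mono)
  qed
  \<comment> \<open>An index \<open>s\<close> in row \<open>m\<close> has
    \<open>|s| >= m div 2 - 1\<close> as integers, hence
    \<open>m <= 2 * |s| + 3 <= 4 * (|s| + 1)\<close>, as \<open>sum_bound\<close> requires.\<close>
  have "norm (coord (LC k p \<Gamma> z) m) \<le> \<bar>a_coef k p \<Gamma>\<bar> * (2 * (D * norm z))"
    unfolding LC.rep_eq LC_seq_def Let_def using False
    by (auto intro!: sum_bound)
  then show ?thesis by (simp add: D_def mult_ac)
\<comment> \<open>For \<open>m = 0\<close> both sides are 0: the coordinate is pinned, and division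
  by zero gives 0.\<close>
qed simp

theorem mainTheorem4:
  fixes p k :: "int ^ 2" and \<Gamma> :: complex
  assumes "p \<noteq> 0" and "k \<noteq> 0" and "\<forall>n :: int. k + n *s p \<noteq> 0"
  shows "compact_op (LC k p \<Gamma>)"
proof (rule compact_op_if_coord_dominated[OF clinear_op_LC _ _ LC_coord_bound[OF assms(1,3)]])
  let ?C = "32 * \<bar>a_coef k p \<Gamma>\<bar> * (2 + vnorm k)\<^sup>2"
  \<comment> \<open>The weight from \<open>LC_coord_bound\<close> is \<open>?C / m\<^sup>2\<close>,
    so its squares are a multiple of the series of \<open>1 / m^4\<close>, whose term at
    \<open>m = 0\<close> is 0 by convention.\<close>
  have "summable (\<lambda>m. ?C\<^sup>2 * inverse (real m ^ 4))"
    by (intro summable_mult inverse_power_summable) simp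
  moreover have "(?C / (real m)\<^sup>2)\<^sup>2 = ?C\<^sup>2 * inverse (real m ^ 4)" for m
    by (simp only: power_divide power_mult[symmetric, of "real m"]) (simp add: divide_inverse)
  ultimately show "summable (\<lambda>m. (?C / (real m)\<^sup>2)\<^sup>2)"
    by presburger
qed simp

end
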